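(* Let $\mathcal U$ be the Hilbert space, $\mathcal Z_N\subset\mathcal U$ the $N$-dimensional background space and $\mathcal U_M=\operatorname{span}\{q_1,\ldots,q_M\}\subset\mathcal U$ the observable space described in the context, with $\mathcal Z_N\cap\mathcal U_M^\perp=\{0\}$, and let $\beta_{N,M}\in(0,1]$ be the associated stability constant. Let $u^{\rm true}\in L^1(I;\mathcal U)$ with time-averaged snapshots $u^{k,\rm true}\in\mathcal U$, and for each $k\in\{1,\ldots,K\}$ let $u^{k,\rm DL}\in\mathcal U_M$. Let $u^{k,*}_{N,M}$ be the PBDW state estimate obtained from the data $u^{k,\rm true}$, and let $u^{k,\rm svda}_{N,M}$ be the SVDA state estimate obtained from the data $u^{k,\rm DL}$ (both defined in the context). Then, for every $k\in\{1,\ldots,K\}$, $$\|u^{k,*}_{N,M}-u^{k,\rm svda}_{N,M}\|\leq\left(1+\frac{2}{\beta_{N,M}}\right)\|\Pi_{\mathcal U_M}u^{k,\rm true}-u^{k,\rm DL}\|$$ and $$\|u^{k,\rm true}-u^{k,\rm svda}_{N,M}\|\leq\left(1+\frac{1}{\beta_{N,M}}\right)\inf_{q\in\mathcal U_M\cap\mathcal Z_N^\perp}\|\Pi_{\mathcal Z_N^\perp}u^{k,\rm true}-q\|+\left(1+\frac{2}{\beta_{N,M}}\right)\|\Pi_{\mathcal U_M}u^{k,\rm true}-u^{k,\rm DL}\|.$$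
   Context: Setting. $\Omega\subset\mathbb R^d$, $d\ge 1$, is open, bounded and connected with Lipschitz boundary. $\mathcal U$ is a real Hilbert space of functions on $\Omega$ with $H^1_0(\Omega)\subset\mathcal U\subset H^1(\Omega)$, with inner product $(\cdot,\cdot)$, induced norm $\|\cdot\|$ and dual space $\mathcal U'$. For a closed subspace $\mathcal Q\subset\mathcal U$, $\mathcal Q^\perp=\{w\in\mathcal U: (w,v)=0\ \forall v\in\mathcal Q\}$ and $\Pi_{\mathcal Q}$ denotes the $\mathcal U$-orthogonal projection onto $\mathcal Q$. Time averages. $I=[0,T]$ with $T>0$, with time nodes $0=t^0<\cdots<t^K=T$, $K\ge 1$. For $k\in\{1,\ldots,K\}$ and $\delta t^k>0$, $\mathcal I^k=[t^k-\delta t^k,t^k+\delta t^k]$ (understood as a time interval on which the function considered is defined and integrable). The time-averaged snapshot of $v\in L^1(I;\mathcal U)$ is $v^k=\frac{1}{|\mathcal I^k|}\int_{\mathcal I^k}v(t,\cdot)\,dt\in\mathcal U$. The results depend on $u^{\rm true}$ only through the elements $u^{k,\rm true}\in\mathcal U$. Spaces. $\mathcal Z_N\subset\mathcal U$ is a linear subspace of dimension $N\ge 1$. Given observation functionals $\ell_1^{\rm obs},\ldots,\ell_M^{\rm obs}\in\mathcal U'$, $q_m\in\mathcal U$ is the Riesz representer of $\ell_m^{\rm obs}$, i.e. $\ell_m^{\rm obs}(v)=(v,q_m)$ for all $v\in\mathcal U$, and $\mathcal U_M=\operatorname{span}\{q_1,\ldots,q_M\}$. It is assumed throughout that $\mathcal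 Z_N\cap\mathcal U_M^\perp=\{0\}$, equivalently that the stability constant $$\beta_{N,M}:=\inf_{w\in\mathcal Z_N\setminus\{0\}}\ \sup_{v\in\mathcal U_M\setminus\{0\}}\frac{(w,v)}{\|w\|\,\|v\|}$$ lies in $(0,1]$. PBDW estimate. For each $k$, $(z^{k,*}_{N,M},\eta^{k,*}_{N,M})\in\mathcal Z_N\times\mathcal U_M$ is the solution of $$(\eta^{k,*}_{N,M},q)+(z^{k,*}_{N,M},q)=(u^{k,\rm true},q)\quad\forall q\in\mathcal U_M,\qquad (\eta^{k,*}_{N,M},p)=0\quad\forall p\in\mathcal Z_N,$$ and $u^{k,*}_{N,M}:=z^{k,*}_{N,M}+\eta^{k,*}_{N,M}$. SVDA estimate. $u^{k,\rm DL}\in\mathcal U_M$ is a field $\sum_{m=1}^M u^{k,\rm DL}_m q_m$ with real coefficients (produced by a statistical prediction of the observations; no accuracy property is assumed). For each $k$, $(z^{k,\rm svda}_{N,M},\eta^{k,\rm svda}_{N,M})\in\mathcal Z_N\times\mathcal U_M$ is the solution of $$(\eta^{k,\rm svda}_{N,M},q)+(z^{k,\rm svda}_{N,M},q)=(u^{k,\rm DL},q)\quad\forall q\in\mathcal U_M,\qquad (\eta^{k,\rm svda}_{N,M},p)=0\quad\forall p\in\mathcal Z_N,$$ and $u^{k,\rm svda}_{N,M}:=z^{k,\rm svda}_{N,M}+\eta^{k,\rm svda}_{N,M}$. *)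

theory Defs
  imports "HOL-Analysis.Analysis"
begin

text \<open>Near each boundary point, and after a rotation taking the unit vector \<open>e\<close> to the vertical
  direction, the set is the strict epigraph of a Lipschitz function of the remaining
  \<open>d - 1\<close> coordinates, i.e. of the component orthogonal to \<open>e\<close>.\<close>

definition lipschitz_boundary :: "(real^'d) set \<Rightarrow> bool" where
  "lipschitz_boundary \<Omega> \<longleftrightarrow>
     (\<forall>x \<in> frontier \<Omega>. \<exists>e \<gamma> L r. norm e = 1 \<and> r > 0 \<and>
        L-lipschitz_on {w. w \<bullet> e = 0} \<gamma> \<and>
        (\<forall>y \<in> ball x r. y \<in> \<Omega> \<longleftrightarrow> \<gamma> (y - (y \<bullet> e) *\<^sub>R e) < y \<bullet> e))"

definition partial_deriv :: "'d \<Rightarrow> (real^'d \<Rightarrow> real) \<Rightarrow> real^'d \<Rightarrow> real" where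
  "partial_deriv i f x = frechet_derivative f (at x) (axis i 1)"

fun Ck :: "nat \<Rightarrow> (real^'d \<Rightarrow> real) \<Rightarrow> bool" where
  "Ck 0 f \<longleftrightarrow> continuous_on UNIV f"
| "Ck (Suc n) f \<longleftrightarrow> f differentiable_on UNIV \<and> (\<forall>i. Ck n (partial_deriv i f))"

definition test_functions :: "(real^'d) set \<Rightarrow> (real^'d \<Rightarrow> real) set" where
  "test_functions \<Omega> =
     {\<phi>. (\<forall>n. Ck n \<phi>) \<and> compact (closure {x. \<phi> x \<noteq> 0}) \<and> closure {x. \<phi> x \<noteq> 0} \<subseteq> \<Omega>}"

text \<open>Elements of the following function spaces are representatives; two of them describe the same
  element when they agree almost everywhere on \<open>\<Omega>\<close>, and their values off \<open>\<Omega>\<close> are irrelevant.\<close>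

definition L2 :: "(real^'d) set \<Rightarrow> (real^'d \<Rightarrow> real) set" where
  "L2 \<Omega> = {f. f \<in> borel_measurable (lebesgue_on \<Omega>) \<and>
               integrable (lebesgue_on \<Omega>) (\<lambda>x. (f x)\<^sup>2)}"

definition weak_partial ::
    "(real^'d) set \<Rightarrow> 'd \<Rightarrow> (real^'d \<Rightarrow> real) \<Rightarrow> (real^'d \<Rightarrow> real) \<Rightarrow> bool" where
  "weak_partial \<Omega> i f g \<longleftrightarrow>
     (\<forall>\<phi> \<in> test_functions \<Omega>.
        (LINT x|lebesgue_on \<Omega>. f x * partial_deriv i \<phi> x) = - (LINT x|lebesgue_on \<Omega>. g x * \<phi> x))"

definition H1 :: "(real^'d) set \<Rightarrow> (real^'d \<Rightarrow> real) set" where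
  "H1 \<Omega> = {f \<in> L2 \<Omega>. \<forall>i. \<exists>g \<in> L2 \<Omega>. weak_partial \<Omega> i f g}"

text \<open>The closure of the test functions in \<open>H1\<close>; \<open>g i\<close> is the weak partial derivative of \<open>f\<close>.\<close>

definition H1_0 :: "(real^'d) set \<Rightarrow> (real^'d \<Rightarrow> real) set" where
  "H1_0 \<Omega> = {f \<in> L2 \<Omega>. \<exists>g \<phi>.
      (\<forall>i. g i \<in> L2 \<Omega> \<and> weak_partial \<Omega> i f (g i)) \<and>
      (\<forall>n. \<phi> n \<in> test_functions \<Omega>) \<and>
      (\<lambda>n. LINT x|lebesgue_on \<Omega>. (\<phi> n x - f x)\<^sup>2) \<longlonglongrightarrow> 0 \<and>
      (\<forall>i. (\<lambda>n. LINT x|lebesgue_on \<Omega>. (partial_deriv i (\<phi> n) x - g i x)\<^sup>2) \<longlonglongrightarrow> 0)}"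

text \<open>The type \<open>'u\<close> is a vector space of functions on \<open>\<Omega>\<close> (modulo null sets) lying between \<open>H1_0\<close>
  and \<open>H1\<close>: \<open>rep u\<close> is a representative of the function \<open>u\<close>. The inner product of \<open>'u\<close> is
  arbitrary; it need not be that of \<open>H1\<close>.\<close>

definition between_H1_0_and_H1 ::
    "(real^'d) set \<Rightarrow> ('u::real_vector \<Rightarrow> real^'d \<Rightarrow> real) \<Rightarrow> bool" where
  "between_H1_0_and_H1 \<Omega> rep \<longleftrightarrow>
     (\<forall>u v. AE x in lebesgue_on \<Omega>. rep (u + v) x = rep u x + rep v x) \<and>
     (\<forall>c u. AE x in lebesgue_on \<Omega>. rep (c *\<^sub>R u) x = c * rep u x) \<and>
     (\<forall>u v. (AE x in lebesgue_on \<Omega>. rep u x = rep v x) \<longrightarrow> u = v) \<and>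
     (\<forall>u. rep u \<in> H1 \<Omega>) \<and>
     (\<forall>f \<in> H1_0 \<Omega>. \<exists>u. AE x in lebesgue_on \<Omega>. rep u x = f x)"


text \<open>The library's \<^const>\<open>has_bochner_integral\<close> requires a second countable range type. Here
  measurability of the integrand is replaced by measurability of its distances to the
  approximating simple functions, which gives the Bochner integral in an arbitrary normed space.\<close>

definition has_strong_integral ::
    "'a measure \<Rightarrow> ('a \<Rightarrow> 'b::real_normed_vector) \<Rightarrow> 'b \<Rightarrow> bool" where
  "has_strong_integral M f y \<longleftrightarrow> (\<exists>s.
     (\<forall>i. Bochner_Integration.simple_bochner_integrable M (s i)) \<and>
     (\<forall>i. (\<lambda>x. norm (f x - s i x)) \<in> borel_measurable M) \<and>
     (\<lambda>i. \<integral>\<^sup>+x. norm (f x - s i x) \<partial>M) \<longlonglongrightarrow> 0 \<and>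
     (\<lambda>i. Bochner_Integration.simple_bochner_integral M (s i)) \<longlonglongrightarrow> y)"

lemma has_strong_integral_if_has_bochner_integral:
  assumes "has_bochner_integral M f y"
  shows "has_strong_integral M f y"
  using assms
proof cases
  case (1 s)
  have "(\<lambda>x. norm (f x - s i x)) \<in> borel_measurable M" for i
  proof -
    have [measurable]: "s i \<in> borel_measurable M"
      using 1(2)[of i] by (auto intro: borel_measurable_simple_function elim: simple_bochner_integrable.cases)
    show ?thesis using 1(1) by measurable
  qed
  with 1 show ?thesis unfolding has_strong_integral_def by blast
qed

lemma has_strong_integral_unique:
  assumes "has_strong_integral M f y" "has_strong_integral M f z"
  shows "y = z"
proof -
  obtain s where s: "\<And>i. Bochner_Integration.simple_bochner_integrable M (s i)"
      and [measurable]: "\<And>i. (\<lambda>x. norm (f x - s i x)) \<in> borel_measurable M"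
      and s0: "(\<lambda>i. \<integral>\<^sup>+x. norm (f x - s i x) \<partial>M) \<longlonglongrightarrow> 0"
      and sy: "(\<lambda>i. Bochner_Integration.simple_bochner_integral M (s i)) \<longlonglongrightarrow> y"
    using assms(1) unfolding has_strong_integral_def by blast
  obtain t where t: "\<And>i. Bochner_Integration.simple_bochner_integrable M (t i)"
      and [measurable]: "\<And>i. (\<lambda>x. norm (f x - t i x)) \<in> borel_measurable M"
      and t0: "(\<lambda>i. \<integral>\<^sup>+x. norm (f x - t i x) \<partial>M) \<longlonglongrightarrow> 0"
      and tz: "(\<lambda>i. Bochner_Integration.simple_bochner_integral M (t i)) \<longlonglongrightarrow> z"
    using assms(2) unfolding has_strong_integral_def by blast
  let ?I = "Bochner_Integration.simple_bochner_integral M"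
  have le: "ennreal (norm (?I (s i) - ?I (t i))) \<le>
      (\<integral>\<^sup>+x. norm (f x - s i x) \<partial>M) + (\<integral>\<^sup>+x. norm (f x - t i x) \<partial>M)" for i
  proof -
    have "ennreal (norm (?I (s i) - ?I (t i))) = norm (?I (\<lambda>x. s i x - t i x))"
      using s t by (subst simple_bochner_integral_diff) auto
    also have "\<dots> \<le> ?I (\<lambda>x. norm (s i x - t i x))"
      using simple_bochner_integrable_compose2[of "(-)" M "s i" "t i"] s t
      by (auto intro!: simple_bochner_integral_norm_bound)
    also have "\<dots> = (\<integral>\<^sup>+x. norm (s i x - t i x) \<partial>M)"
      using simple_bochner_integrable_compose2[of "\<lambda>x y. norm (x - y)" M "s i" "t i"] s t
      by (auto intro!: simple_bochner_integral_eq_nn_integral)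
    also have "\<dots> \<le> (\<integral>\<^sup>+x. ennreal (norm (f x - s i x)) + ennreal (norm (f x - t i x)) \<partial>M)"
    proof (rule nn_integral_mono)
      fix x
      have "norm (s i x - t i x) \<le> norm (f x - s i x) + norm (f x - t i x)"
        by (metis dual_order.refl norm_diff_triangle_le norm_minus_commute)
      then show "ennreal (norm (s i x - t i x)) \<le> ennreal (norm (f x - s i x)) + ennreal (norm (f x - t i x))"
        by (metis ennreal_leI ennreal_plus norm_ge_zero)
    qed
    also have "\<dots> = (\<integral>\<^sup>+x. norm (f x - s i x) \<partial>M) + (\<integral>\<^sup>+x. norm (f x - t i x) \<partial>M)"
      by (rule nn_integral_add) auto
    finally show ?thesis .
  qed
  have "(\<lambda>i. (\<integral>\<^sup>+x. norm (f x - s i x) \<partial>M) + (\<integral>\<^sup>+x. norm (f x - t i x) \<partial>M)) \<longlonglongrightarrow> 0"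
    using tendsto_add[OF s0 t0] by simp
  from tendsto_sandwich[OF _ _ tendsto_const this]
  have "(\<lambda>i. ennreal (norm (?I (s i) - ?I (t i)))) \<longlonglongrightarrow> 0"
    using le by (simp add: always_eventually)
  moreover have "(\<lambda>i. ennreal (norm (?I (s i) - ?I (t i)))) \<longlonglongrightarrow> ennreal (norm (y - z))"
    by (intro tendsto_ennrealI tendsto_norm tendsto_diff sy tz)
  ultimately have "ennreal (norm (y - z)) = 0"
    using LIMSEQ_unique by blast
  then show ?thesis by simp
qed

definition strongly_integrable_on :: "(real \<Rightarrow> 'b::real_normed_vector) \<Rightarrow> real set \<Rightarrow> bool" where
  "strongly_integrable_on v S \<longleftrightarrow> (\<exists>y. has_strong_integral (lebesgue_on S) v y)"

definition strong_integral :: "real set \<Rightarrow> (real \<Rightarrow> 'b::real_normed_vector) \<Rightarrow> 'b" where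
  "strong_integral S v = (THE y. has_strong_integral (lebesgue_on S) v y)"

definition time_average :: "real set \<Rightarrow> (real \<Rightarrow> 'b::real_normed_vector) \<Rightarrow> 'b" where
  "time_average J v = (1 / measure lebesgue J) *\<^sub>R strong_integral J v"


definition orth_proj :: "'u::real_inner set \<Rightarrow> 'u \<Rightarrow> 'u" where
  "orth_proj Q u = (THE p. p \<in> Q \<and> u - p \<in> Q\<^sup>\<bottom>)"

definition stability_const :: "'u::real_inner set \<Rightarrow> 'u set \<Rightarrow> real" where
  "stability_const Z U = (INF w \<in> Z - {0}. SUP v \<in> U - {0}. (w \<bullet> v) / (norm w * norm v))"

definition is_saddle_solution ::
    "'u::real_inner set \<Rightarrow> 'u set \<Rightarrow> 'u \<Rightarrow> 'u \<times> 'u \<Rightarrow> bool" where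
  "is_saddle_solution Z U d = (\<lambda>(z, \<eta>). z \<in> Z \<and> \<eta> \<in> U \<and>
     (\<forall>q \<in> U. \<eta> \<bullet> q + z \<bullet> q = d \<bullet> q) \<and> (\<forall>p \<in> Z. \<eta> \<bullet> p = 0))"

text \<open>The PBDW and SVDA estimates solve the same system and differ only in the data \<open>d\<close>:
  the true snapshot for PBDW, the predicted field for SVDA.\<close>

definition state_estimate :: "'u::real_inner set \<Rightarrow> 'u set \<Rightarrow> 'u \<Rightarrow> 'u" where
  "state_estimate Z U d = (let (z, \<eta>) = (THE p. is_saddle_solution Z U d p) in z + \<eta>)"

end

theory Submission
  imports Defs
begin

text \<open>Write \<open>P\<close> for the orthogonal projection onto \<open>U\<close>. A saddle solution \<open>(z, \<eta>)\<close> for the data \<open>d\<close>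
  splits \<open>P d = P z + \<eta>\<close> orthogonally, since \<open>\<eta> \<in> U\<close> is orthogonal to \<open>z\<close> and hence to \<open>P z\<close>.
  Therefore \<open>\<beta> \<parallel>z\<parallel> \<le> \<parallel>P z\<parallel> \<le> \<parallel>P d\<parallel>\<close> and \<open>\<parallel>\<eta>\<parallel> \<le> \<parallel>P d\<parallel>\<close>, which bounds the estimate by
  \<open>1 + 1/\<beta>\<close> times the size of the data. For the error, \<open>d - (z + \<eta>) = (d - P d) + (P z - z)\<close>,
  and subtracting from \<open>d\<close> an element of \<open>Z\<close> or of \<open>U \<inter> Z\<^sup>\<bottom>\<close>, both reproduced exactly by the
  estimate, leaves this error unchanged. Positivity of \<open>\<beta>\<close> needs no compactness: \<open>P\<close> is injective on
  \<open>Z\<close>, and a linear left inverse of it is bounded on the finite-dimensional space \<open>P ` Z\<close>.\<close>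

section \<open>Orthonormal bases of finitely spanned subspaces\<close>

lemma mem_orthogonal_comp_iff: "x \<in> W\<^sup>\<bottom> \<longleftrightarrow> (\<forall>y\<in>W. x \<bullet> y = 0)"
  by (auto simp: orthogonal_comp_def orthogonal_def inner_commute)

text \<open>Gram-Schmidt by induction on \<open>S\<close>: the part of the new vector orthogonal to
  the current span is normalised, or dropped if it vanishes. Hence \<open>S\<close> may be linearly
  dependent.\<close>

lemma finite_span_orthonormal_basis:
  fixes S :: "'a::real_inner set"
  assumes "finite S"
  obtains B where "finite B" "span B = span S"
    "\<And>b c. b \<in> B \<Longrightarrow> c \<in> B \<Longrightarrow> b \<bullet> c = (if b = c then 1 else 0)"
proof -
  from assms have "\<exists>B. finite B \<and> span B = span S \<and>
      (\<forall>b\<in>B. \<forall>c\<in>B. b \<bullet> c = (if b = c then 1 else 0))"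
  proof induction
    case empty
    then show ?case by (intro exI[of _ "{}"]) auto
  next
    case (insert x S)
    then obtain B where B: "finite B" "span B = span S"
      and on: "\<And>b c. b \<in> B \<Longrightarrow> c \<in> B \<Longrightarrow> b \<bullet> c = (if b = c then 1 else 0)"
      by blast
    define p where "p = (\<Sum>b\<in>B. (x \<bullet> b) *\<^sub>R b)"
    have p: "p \<in> span B"
      unfolding p_def by (intro span_sum span_scale span_base)
    have orth: "(x - p) \<bullet> c = 0" if "c \<in> B" for c
      using that B(1) by (simp add: p_def inner_diff_left inner_sum_left on sum.delta if_distrib cong: if_cong)
    show ?case
    proof (cases "x = p")
      case True
      then have "span (insert x S) = span S"
        using p B(2) by (simp add: span_redundant)
      then show ?thesis using B on by (intro exI[of _ B]) auto
    next
      case False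
      define e where "e = (1 / norm (x - p)) *\<^sub>R (x - p)"
      have e1: "e \<bullet> e = 1"
        using False by (simp add: e_def dot_square_norm power2_eq_square)
      have e0: "e \<bullet> c = 0" "c \<bullet> e = 0" if "c \<in> B" for c
        using orth[OF that] by (auto simp: e_def inner_commute)
      have eB: "e \<notin> B" using e0 e1 by force
      have x: "x = norm (x - p) *\<^sub>R e + p"
        using False by (simp add: e_def)
      have "span (insert e B) = span (insert x S)"
      proof (rule span_eq[THEN iffD2], intro conjI)
        have pS: "p \<in> span (insert x S)"
          using p B(2) span_mono[of S "insert x S"] by blast
        then have "e \<in> span (insert x S)"
          unfolding e_def by (intro span_scale span_diff) (auto intro: span_base)
        moreover have "B \<subseteq> span (insert x S)"
          using B(2) span_superset[of B] span_mono[of S "insert x S"] by blast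
        ultimately show "insert e B \<subseteq> span (insert x S)" by blast
        have "p \<in> span (insert e B)"
          using p span_mono[of B "insert e B"] by blast
        then have "x \<in> span (insert e B)"
          by (subst x) (intro span_add span_scale, auto intro: span_base)
        moreover have "S \<subseteq> span (insert e B)"
          using B(2) span_superset[of S] span_mono[of B "insert e B"] by blast
        ultimately show "insert x S \<subseteq> span (insert e B)" by blast
      qed
      then show ?thesis
        using B(1) on e0 e1 eB by (intro exI[of _ "insert e B"]) auto
    qed
  qed
  then show ?thesis using that by blast
qed

text \<open>The Fourier sum over an orthonormal basis leaves a residual orthogonal to each basis
  vector, hence to the whole span.\<close>

lemma orthogonal_decomposition_exists:
  fixes S :: "'a::real_inner set"
  assumes "finite S"
  shows "\<exists>p \<in> span S. u - p \<in> (span S)\<^sup>\<bottom>"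
proof -
  obtain B where B: "finite B" "span B = span S"
    and on: "\<And>b c. b \<in> B \<Longrightarrow> c \<in> B \<Longrightarrow> b \<bullet> c = (if b = c then 1 else 0)"
    using finite_span_orthonormal_basis[OF assms] by blast
  define p where "p = (\<Sum>b\<in>B. (u \<bullet> b) *\<^sub>R b)"
  have "p \<in> span B"
    unfolding p_def by (intro span_sum span_scale span_base)
  moreover have "(u - p) \<bullet> c = 0" if "c \<in> B" for c
    using that B(1) by (simp add: p_def inner_diff_left inner_sum_left on sum.delta if_distrib cong: if_cong)
  then have "(u - p) \<bullet> y = 0" if "y \<in> span B" for y
    using orthogonal_to_span[OF that, of "u - p"] by (simp add: orthogonal_def)
  ultimately show ?thesis
    using B(2) by (auto simp: mem_orthogonal_comp_iff)
qed

lemma linear_bounded_on_finite_span: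
  fixes S :: "'a::real_inner set" and g :: "'a \<Rightarrow> 'b::real_normed_vector"
  assumes "finite S" "linear g"
  obtains C where "C > 0" "\<And>y. y \<in> span S \<Longrightarrow> norm (g y) \<le> C * norm y"
proof -
  obtain B where B: "finite B" "span B = span S"
    and on: "\<And>b c. b \<in> B \<Longrightarrow> c \<in> B \<Longrightarrow> b \<bullet> c = (if b = c then 1 else 0)"
    using finite_span_orthonormal_basis[OF assms(1)] by blast
  \<comment> \<open>By Cauchy-Schwarz each coordinate of \<open>y\<close> is at most
    \<open>norm y\<close>, so the sum alone would bound \<open>g\<close>. The added 1 only keeps the
    constant positive when that sum is 0.\<close>
  have "norm (g y) \<le> (1 + (\<Sum>b\<in>B. norm (g b))) * norm y" if y: "y \<in> span S" for y
  proof -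
    obtain a where a: "y = (\<Sum>b\<in>B. a b *\<^sub>R b)"
      using y span_finite[OF B(1)] unfolding B(2) by blast
    have a_eq: "a b = y \<bullet> b" if "b \<in> B" for b
      using that B(1) by (simp add: a inner_sum_left on sum.delta if_distrib cong: if_cong)
    have "norm (g y) = norm (\<Sum>b\<in>B. a b *\<^sub>R g b)"
      by (simp add: a linear_sum[OF assms(2)] linear_scale[OF assms(2)])
    also have "\<dots> \<le> (\<Sum>b\<in>B. \<bar>a b\<bar> * norm (g b))"
      by (rule order_trans[OF norm_sum]) simp
    also have "\<dots> \<le> (\<Sum>b\<in>B. norm y * norm (g b))"
    proof (intro sum_mono mult_right_mono)
      fix b assume b: "b \<in> B"
      then have "norm b = 1" using on[OF b b] by (simp add: norm_eq_1)
      then show "\<bar>a b\<bar> \<le> norm y"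
        using Cauchy_Schwarz_ineq2[of y b] a_eq[OF b] by simp
    qed simp
    finally show ?thesis
      by (simp add: sum_distrib_left algebra_simps) (smt (verit) norm_ge_zero)
  qed
  moreover have "1 + (\<Sum>b\<in>B. norm (g b)) > 0"
    by (simp add: add_pos_nonneg sum_nonneg)
  ultimately show ?thesis using that by blast
qed

section \<open>The orthogonal projection as an operator\<close>

lemma orth_proj_eqI:
  assumes "subspace Q" "p \<in> Q" "u - p \<in> Q\<^sup>\<bottom>"
  shows "orth_proj Q u = p"
  unfolding orth_proj_def
proof (rule the_equality)
  fix p' assume p': "p' \<in> Q \<and> u - p' \<in> Q\<^sup>\<bottom>"
  \<comment> \<open>Two candidates differ by a vector that lies in \<open>Q\<close> and is
    orthogonal to \<open>Q\<close>, hence to itself.\<close>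
  have mem: "p' - p \<in> Q" using assms p' by (simp add: subspace_diff)
  have "(u - p) \<bullet> (p' - p) = 0" "(u - p') \<bullet> (p' - p) = 0"
    using mem assms(3) p' unfolding mem_orthogonal_comp_iff by blast+
  then have "((u - p) - (u - p')) \<bullet> (p' - p) = 0"
    by (simp only: inner_diff_left[of "u - p" "u - p'"])
  then show "p' = p" by simp
qed (use assms in simp)

context
  fixes Q S :: "'a::real_inner set"
  assumes finite_S: "finite S" and Q_eq: "Q = span S"
begin

lemma orth_proj_mem: "orth_proj Q u \<in> Q"
  and orth_proj_residual: "u - orth_proj Q u \<in> Q\<^sup>\<bottom>"
proof -
  obtain p where "p \<in> Q" "u - p \<in> Q\<^sup>\<bottom>"
    using orthogonal_decomposition_exists[OF finite_S, of u] unfolding Q_eq by blast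
  then show "orth_proj Q u \<in> Q" "u - orth_proj Q u \<in> Q\<^sup>\<bottom>"
    using orth_proj_eqI[of Q p u] by (simp_all add: Q_eq)
qed

lemma inner_orth_proj: "v \<in> Q \<Longrightarrow> orth_proj Q u \<bullet> v = u \<bullet> v"
  using orth_proj_residual[of u] by (auto simp: mem_orthogonal_comp_iff inner_diff_left)

lemma linear_orth_proj: "linear (orth_proj Q)"
proof (rule linearI)
  have Q: "subspace Q" by (simp add: Q_eq)
  show "orth_proj Q (x + y) = orth_proj Q x + orth_proj Q y" for x y
    by (rule orth_proj_eqI[OF Q])
      (auto simp: Q orth_proj_mem subspace_add mem_orthogonal_comp_iff inner_diff_left inner_add_left inner_orth_proj)
  show "orth_proj Q (c *\<^sub>R x) = c *\<^sub>R orth_proj Q x" for c x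
    by (rule orth_proj_eqI[OF Q])
      (auto simp: Q orth_proj_mem subspace_scale mem_orthogonal_comp_iff inner_diff_left inner_orth_proj)
qed

lemma orth_proj_fixed: "u \<in> Q \<Longrightarrow> orth_proj Q u = u"
  by (rule orth_proj_eqI) (auto simp: Q_eq mem_orthogonal_comp_iff)

text \<open>Works although the complement may be infinite-dimensional:
  \<open>u - orth_proj Q u\<close> lies in it, and what remains, \<open>orth_proj Q u\<close>, is
  orthogonal to it.\<close>

lemma orth_proj_orthogonal_comp: "orth_proj (Q\<^sup>\<bottom>) u = u - orth_proj Q u"
proof (rule orth_proj_eqI)
  show "u - (u - orth_proj Q u) \<in> Q\<^sup>\<bottom>\<^sup>\<bottom>"
    using orth_proj_mem[of u] by (auto simp: mem_orthogonal_comp_iff inner_commute)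
qed (simp_all add: orth_proj_residual subspace_orthogonal_comp)

lemma norm_orth_proj_Pythagoras:
  "(norm u)\<^sup>2 = (norm (orth_proj Q u))\<^sup>2 + (norm (u - orth_proj Q u))\<^sup>2"
proof -
  have "(u - orth_proj Q u) \<bullet> orth_proj Q u = 0"
    using inner_orth_proj[OF orth_proj_mem, of u u] by (simp add: inner_diff_left)
  then show ?thesis
    by (simp add: power2_norm_eq_inner inner_diff_left inner_diff_right inner_commute)
qed

lemma norm_orth_proj_le: "norm (orth_proj Q u) \<le> norm u"
  and norm_orth_proj_residual_le: "norm (u - orth_proj Q u) \<le> norm u"
  by (rule power2_le_imp_le; simp add: norm_orth_proj_Pythagoras[of u])+

end

section \<open>Linearity of the saddle system and the data it reproduces\<close>

lemma is_saddle_solution_diff: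
  assumes "subspace Z" "subspace U"
    and "is_saddle_solution Z U d (z, \<eta>)" "is_saddle_solution Z U d' (z', \<eta>')"
  shows "is_saddle_solution Z U (d - d') (z - z', \<eta> - \<eta>')"
  unfolding is_saddle_solution_def prod.case
proof (intro conjI ballI)
  fix q assume "q \<in> U"
  then have "\<eta> \<bullet> q + z \<bullet> q = d \<bullet> q" "\<eta>' \<bullet> q + z' \<bullet> q = d' \<bullet> q"
    using assms(3,4) by (auto simp: is_saddle_solution_def)
  then show "(\<eta> - \<eta>') \<bullet> q + (z - z') \<bullet> q = (d - d') \<bullet> q"
    by (simp add: inner_diff_left)
qed (use assms in \<open>auto simp: is_saddle_solution_def subspace_diff inner_diff_left\<close>)

lemma is_saddle_solution_reproduce:
  assumes "subspace Z" "subspace U" "z \<in> Z" "p \<in> U \<inter> Z\<^sup>\<bottom>"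
  shows "is_saddle_solution Z U (z + p) (z, p)"
  using assms by (auto simp: is_saddle_solution_def mem_orthogonal_comp_iff inner_add_left)

section \<open>Injectivity of the projection on the background space and the stability
  constant\<close>

locale stable_pair =
  fixes Z U A B :: "'u::real_inner set"
  assumes finite_A: "finite A" and Z_eq: "Z = span A"
    and finite_B: "finite B" and U_eq: "U = span B"
    and Z_nontrivial: "Z \<noteq> {0}" and stable: "Z \<inter> U\<^sup>\<bottom> = {0}"
begin

abbreviation P where "P \<equiv> orth_proj U"

lemma subspace_Z: "subspace Z" and subspace_U: "subspace U"
  by (simp_all add: Z_eq U_eq)

lemmas P_mem = orth_proj_mem[OF finite_B U_eq]
lemmas inner_P = inner_orth_proj[OF finite_B U_eq]
lemmas linear_P = linear_orth_proj[OF finite_B U_eq]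

lemma P_eq_0_iff: "w \<in> Z \<Longrightarrow> P w = 0 \<longleftrightarrow> w = 0"
proof
  assume "w \<in> Z" "P w = 0"
  then have "w \<in> Z \<inter> U\<^sup>\<bottom>"
    using orth_proj_residual[OF finite_B U_eq, of w] by simp
  then show "w = 0" using stable by blast
qed (simp add: linear_0[OF linear_P])

lemma inj_on_P: "inj_on P Z"
  by (rule inj_onI)
    (metis P_eq_0_iff linear_diff[OF linear_P] right_minus_eq subspace_Z subspace_diff)

lemma P_bounded_below:
  obtains c where "c > 0" "\<And>w. w \<in> Z \<Longrightarrow> c * norm w \<le> norm (P w)"
proof -
  obtain g where g: "linear g" "\<And>w. w \<in> Z \<Longrightarrow> g (P w) = w"
    using linear_exists_left_inverse_on[OF linear_P subspace_Z inj_on_P] by blast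
  obtain C where C: "C > 0" "\<And>y. y \<in> span (P ` A) \<Longrightarrow> norm (g y) \<le> C * norm y"
    using linear_bounded_on_finite_span[OF finite_imageI[OF finite_A] g(1)] by blast
  have "(1 / C) * norm w \<le> norm (P w)" if w: "w \<in> Z" for w
  proof -
    have "P w \<in> span (P ` A)"
      using w linear_span_image[OF linear_P, of A] by (simp add: Z_eq)
    then have "norm w \<le> C * norm (P w)" using C(2)[of "P w"] g(2)[OF w] by simp
    then show ?thesis using C(1) by (simp add: field_simps)
  qed
  then show ?thesis using that[of "1 / C"] C(1) by simp
qed

text \<open>The inner supremum of \<open>stability_const\<close> at a fixed
  \<open>w\<close>.\<close>

definition gain :: "'u \<Rightarrow> real" where
  "gain w = (SUP v \<in> U - {0}. (w \<bullet> v) / (norm w * norm v))"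

text \<open>Against \<open>v\<close> in \<open>U\<close>, \<open>w\<close> may be replaced by
  \<open>P w\<close>. Cauchy-Schwarz then bounds the quotient, and \<open>v = P w\<close>, nonzero
  by stability, attains the bound.\<close>

lemma gain_eq:
  assumes "w \<in> Z" "w \<noteq> 0"
  shows "gain w = norm (P w) / norm w"
  unfolding gain_def
proof (rule cSup_eq_maximum)
  have "P w \<noteq> 0" using assms by (simp add: P_eq_0_iff)
  moreover have "w \<bullet> P w = norm (P w) * norm (P w)"
    using inner_P[OF P_mem, of w w] by (simp add: dot_square_norm power2_eq_square)
  ultimately have "P w \<noteq> 0" "(w \<bullet> P w) / (norm w * norm (P w)) = norm (P w) / norm w"
    by simp_all
  then show "norm (P w) / norm w \<in> (\<lambda>v. (w \<bullet> v) / (norm w * norm v)) ` (U - {0})"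
    using P_mem by (intro image_eqI[of _ _ "P w"]) simp_all
next
  fix x assume "x \<in> (\<lambda>v. (w \<bullet> v) / (norm w * norm v)) ` (U - {0})"
  then obtain v where v: "v \<in> U" "v \<noteq> 0" "x = (P w \<bullet> v) / (norm w * norm v)"
    by (auto simp: inner_P)
  then show "x \<le> norm (P w) / norm w"
    using divide_right_mono[OF norm_cauchy_schwarz[of "P w" v], of "norm w * norm v"] by simp
qed

lemma stability_const_eq: "stability_const Z U = (INF w \<in> Z - {0}. norm (P w) / norm w)"
  unfolding stability_const_def gain_def[symmetric] by (rule INF_cong) (auto simp: gain_eq)

lemma stability_const_pos: "stability_const Z U > 0"
proof -
  obtain c where c: "c > 0" "\<And>w. w \<in> Z \<Longrightarrow> c * norm w \<le> norm (P w)"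
    using P_bounded_below by blast
  \<comment> \<open>A lower bound passes to an infimum of reals only over a nonempty index
    set.\<close>
  have "Z - {0} \<noteq> {}" using Z_nontrivial subspace_0[OF subspace_Z] by blast
  then have "c \<le> stability_const Z U"
    unfolding stability_const_eq using c(2) by (intro cINF_greatest) (auto simp: field_simps)
  with c(1) show ?thesis by simp
qed

lemma stability_const_le:
  assumes "w \<in> Z"
  shows "stability_const Z U * norm w \<le> norm (P w)"
proof (cases "w = 0")
  case False
  have "bdd_below ((\<lambda>w. norm (P w) / norm w) ` (Z - {0}))"
    by (rule bdd_belowI[of _ 0]) auto
  then have "stability_const Z U \<le> norm (P w) / norm w"
    unfolding stability_const_eq using assms False by (intro cINF_lower) auto
  then show ?thesis using False by (simp add: field_simps)
qed simp

section \<open>A priori bounds for a saddle solution\<close>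

context
  fixes d z \<eta>
  assumes sol: "is_saddle_solution Z U d (z, \<eta>)"
begin

text \<open>The first equation makes \<open>d - z - \<eta>\<close> orthogonal to \<open>U\<close>,
  and replacing \<open>z\<close> by \<open>P z\<close> does not change inner products with
  \<open>U\<close>.\<close>

lemma saddle_split: "P d = P z + \<eta>"
proof (rule orth_proj_eqI[OF subspace_U])
  show "P z + \<eta> \<in> U"
    using sol subspace_U P_mem by (auto simp: is_saddle_solution_def subspace_add)
  show "d - (P z + \<eta>) \<in> U\<^sup>\<bottom>"
    using sol by (auto simp: is_saddle_solution_def mem_orthogonal_comp_iff inner_P inner_diff_left inner_add_left)
qed

lemma saddle_Pythagoras: "(norm (P d))\<^sup>2 = (norm (P z))\<^sup>2 + (norm \<eta>)\<^sup>2"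
proof -
  have "P z \<bullet> \<eta> = 0" using sol by (auto simp: is_saddle_solution_def inner_P inner_commute[of z])
  then show ?thesis
    unfolding saddle_split
    by (simp add: power2_norm_eq_inner inner_add_left inner_add_right inner_commute)
qed

lemma saddle_z_le: "norm z \<le> norm (P d) / stability_const Z U"
proof -
  have "stability_const Z U * norm z \<le> norm (P z)"
    using sol by (intro stability_const_le) (simp add: is_saddle_solution_def)
  also have "\<dots> \<le> norm (P d)" by (rule power2_le_imp_le) (simp_all add: saddle_Pythagoras)
  finally show ?thesis using stability_const_pos by (simp add: field_simps)
qed

lemma saddle_eta_le: "norm \<eta> \<le> norm (P d)"
  by (rule power2_le_imp_le) (simp_all add: saddle_Pythagoras)

lemma saddle_norm_le: "norm (z + \<eta>) \<le> (1 + 1 / stability_const Z U) * norm (P d)"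
  using norm_triangle_ineq[of z \<eta>] saddle_z_le saddle_eta_le by (simp add: algebra_simps)

text \<open>Bounding the two residuals of \<open>P\<close> separately gives the constant
  \<open>1 + 1/\<beta>\<close>; the triangle inequality with \<open>saddle_norm_le\<close> would
  give only \<open>2 + 1/\<beta>\<close>.\<close>

lemma saddle_error_le: "norm (d - (z + \<eta>)) \<le> (1 + 1 / stability_const Z U) * norm d"
proof -
  have "d - (z + \<eta>) = (d - P d) - (z - P z)" using saddle_split by simp
  then have "norm (d - (z + \<eta>)) \<le> norm (d - P d) + norm (z - P z)"
    by (metis norm_triangle_ineq4)
  also have "\<dots> \<le> norm d + norm z"
    by (intro add_mono norm_orth_proj_residual_le[OF finite_B U_eq])
  also have "norm z \<le> norm d / stability_const Z U"
    using saddle_z_le norm_orth_proj_le[OF finite_B U_eq, of d] stability_const_pos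
    by (smt (verit) divide_right_mono)
  finally show ?thesis by (simp add: algebra_simps)
qed

end

section \<open>Existence and uniqueness of the saddle solution\<close>

lemma saddle_solution_exists: "\<exists>z \<eta>. is_saddle_solution Z U d (z, \<eta>)"
proof -
  define V where "V = span (P ` A)"
  have V: "finite (P ` A)" "V = span (P ` A)" by (simp_all add: finite_A V_def)
  have V_eq: "V = P ` Z" using linear_span_image[OF linear_P] by (simp add: V_def Z_eq)
  \<comment> \<open>A least-squares choice: \<open>P z\<close> is the point of \<open>P\<close>
    Z\<open>nearest to\<close>P
    d\<open>, so the remainder\<close>\<eta>\<open>is orthogonal to\<close>P \<open>Z\<close> and,
    lying in \<open>U\<close>, to \<open>Z\<close>.\<close>
  obtain z where z: "z \<in> Z" "P z = orth_proj V (P d)"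
    using orth_proj_mem[OF V, of "P d"] unfolding V_eq by force
  define \<eta> where "\<eta> = P d - P z"
  have \<eta>: "\<eta> \<in> U" unfolding \<eta>_def by (intro subspace_diff subspace_U P_mem)
  have "\<eta> \<bullet> p = 0" if "p \<in> Z" for p
  proof -
    have "P p \<in> V" using that V_eq by blast
    then have "\<eta> \<bullet> P p = 0"
      using orth_proj_residual[OF V, of "P d"] z(2) by (simp add: \<eta>_def mem_orthogonal_comp_iff)
    then show ?thesis using inner_P[OF \<eta>, of p] by (simp add: inner_commute)
  qed
  moreover have "\<eta> \<bullet> q + z \<bullet> q = d \<bullet> q" if "q \<in> U" for q
    using that by (simp add: \<eta>_def inner_diff_left inner_P)
  ultimately show ?thesis
    using z(1) \<eta> by (auto simp: is_saddle_solution_def)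
qed

lemma saddle_solution_unique:
  assumes "is_saddle_solution Z U d (z, \<eta>)" "is_saddle_solution Z U d (z', \<eta>')"
  shows "z = z' \<and> \<eta> = \<eta>'"
proof -
  \<comment> \<open>The difference solves the system with zero data, so the a priori bounds force it
    to vanish.\<close>
  have "is_saddle_solution Z U 0 (z - z', \<eta> - \<eta>')"
    using is_saddle_solution_diff[OF subspace_Z subspace_U assms] by simp
  from saddle_z_le[OF this] saddle_eta_le[OF this] show ?thesis
    by (simp add: linear_0[OF linear_P])
qed

section \<open>Bounds for the state estimates\<close>

lemma state_estimate_solution:
  obtains z \<eta> where "is_saddle_solution Z U d (z, \<eta>)" "state_estimate Z U d = z + \<eta>"
proof -
  obtain z \<eta> where sol: "is_saddle_solution Z U d (z, \<eta>)"
    using saddle_solution_exists by blast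
  then have "(THE p. is_saddle_solution Z U d p) = (z, \<eta>)"
    by (intro the_equality) (auto dest: saddle_solution_unique)
  then show ?thesis using that[OF sol] by (simp add: state_estimate_def)
qed

text \<open>Only the projected data enter on the right, because \<open>saddle_norm_le\<close>
  measures the data through \<open>P\<close>.\<close>

lemma norm_state_estimate_diff_le:
  "norm (state_estimate Z U d - state_estimate Z U d')
     \<le> (1 + 1 / stability_const Z U) * norm (P (d - d'))"
proof -
  obtain z \<eta> where s: "is_saddle_solution Z U d (z, \<eta>)" "state_estimate Z U d = z + \<eta>"
    by (rule state_estimate_solution)
  obtain z' \<eta>' where s': "is_saddle_solution Z U d' (z', \<eta>')" "state_estimate Z U d' = z' + \<eta>'"
    by (rule state_estimate_solution)
  show ?thesis
    using saddle_norm_le[OF is_saddle_solution_diff[OF subspace_Z subspace_U s(1) s'(1)]] s(2) s'(2)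
    by (simp add: algebra_simps)
qed

lemma norm_state_estimate_error_le:
  "norm (u - state_estimate Z U u)
     \<le> (1 + 1 / stability_const Z U) * (INF p \<in> U \<inter> Z\<^sup>\<bottom>. norm (orth_proj (Z\<^sup>\<bottom>) u - p))"
proof -
  let ?c = "1 + 1 / stability_const Z U"
  have c: "?c > 0" using stability_const_pos by (simp add: add_pos_pos)
  obtain z \<eta> where s: "is_saddle_solution Z U u (z, \<eta>)" "state_estimate Z U u = z + \<eta>"
    by (rule state_estimate_solution)
  let ?w = "orth_proj Z u"
  have w: "?w \<in> Z" by (rule orth_proj_mem[OF finite_A Z_eq])
  \<comment> \<open>Dividing by the positive \<open>?c\<close> isolates a lower bound for each
    competitor \<open>p\<close>, which then passes to the infimum.\<close>
  have "norm (u - state_estimate Z U u) / ?c \<le> norm (orth_proj (Z\<^sup>\<bottom>) u - p)"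
    if p: "p \<in> U \<inter> Z\<^sup>\<bottom>" for p
  proof -
    \<comment> \<open>Subtracting the reproduced element \<open>?w + p\<close> keeps the error and
      reduces the data to \<open>u - ?w - p\<close>, where \<open>u - ?w\<close> is the projection
      of \<open>u\<close> onto \<open>Z\<^sup>\<bottom>\<close>.\<close>
    have "is_saddle_solution Z U (u - (?w + p)) (z - ?w, \<eta> - p)"
      by (intro is_saddle_solution_diff subspace_Z subspace_U s(1) is_saddle_solution_reproduce w p)
    from saddle_error_le[OF this]
    have "norm (u - (z + \<eta>)) \<le> ?c * norm (u - ?w - p)"
      by (simp add: algebra_simps)
    then show ?thesis
      using c s(2) by (simp add: orth_proj_orthogonal_comp[OF finite_A Z_eq] pos_divide_le_eq mult.commute)
  qed
  moreover have "0 \<in> U \<inter> Z\<^sup>\<bottom>"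
    using subspace_0[OF subspace_U] by (simp add: mem_orthogonal_comp_iff)
  ultimately have "norm (u - state_estimate Z U u) / ?c
      \<le> (INF p \<in> U \<inter> Z\<^sup>\<bottom>. norm (orth_proj (Z\<^sup>\<bottom>) u - p))"
    by (intro cINF_greatest) auto
  then show ?thesis using c by (simp add: pos_divide_le_eq mult.commute)
qed

end

theorem proposition2:
  fixes \<Omega> :: "(real^'d) set"
    and rep :: "'u::{real_inner, complete_space} \<Rightarrow> real^'d \<Rightarrow> real"
    and T :: real and K :: nat and t \<delta> :: "nat \<Rightarrow> real" and J :: "nat \<Rightarrow> real set"
    and N M :: nat and Z U\<^sub>M :: "'u set"
    and l_obs :: "nat \<Rightarrow> 'u \<Rightarrow> real" and q :: "nat \<Rightarrow> 'u"
    and \<beta> :: real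
    and u_true :: "real \<Rightarrow> 'u" and uk_true uk_DL uk_PBDW uk_SVDA :: "nat \<Rightarrow> 'u"
  assumes domain: "open \<Omega>" "bounded \<Omega>" "connected \<Omega>" "lipschitz_boundary \<Omega>"
    and function_space: "between_H1_0_and_H1 \<Omega> rep"
    and time_nodes: "T > 0" "K \<ge> 1" "t 0 = 0" "t K = T" "\<And>k. k < K \<Longrightarrow> t k < t (Suc k)"
    and windows: "\<And>k. k \<in> {1..K} \<Longrightarrow> \<delta> k > 0" "\<And>k. J k = {t k - \<delta> k .. t k + \<delta> k}"
    and background: "subspace Z" "dim Z = N" "N \<ge> 1"
    and observations: "\<And>m. m \<in> {1..M} \<Longrightarrow> bounded_linear (l_obs m)"
    and riesz: "\<And>m v. m \<in> {1..M} \<Longrightarrow> l_obs m v = v \<bullet> q m"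
    and observable: "U\<^sub>M = span (q ` {1..M})"
    and stable: "Z \<inter> U\<^sub>M\<^sup>\<bottom> = {0}"
    and beta: "\<beta> = stability_const Z U\<^sub>M"
    and u_true: "strongly_integrable_on u_true {0..T}"
      "\<And>k. k \<in> {1..K} \<Longrightarrow> strongly_integrable_on u_true (J k)"
    and snapshots: "\<And>k. k \<in> {1..K} \<Longrightarrow> uk_true k = time_average (J k) u_true"
    and DL: "\<And>k. k \<in> {1..K} \<Longrightarrow> uk_DL k \<in> U\<^sub>M"
    and PBDW: "\<And>k. k \<in> {1..K} \<Longrightarrow> uk_PBDW k = state_estimate Z U\<^sub>M (uk_true k)"
    and SVDA: "\<And>k. k \<in> {1..K} \<Longrightarrow> uk_SVDA k = state_estimate Z U\<^sub>M (uk_DL k)"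
  shows "\<forall>k \<in> {1..K}.
     norm (uk_PBDW k - uk_SVDA k)
       \<le> (1 + 2 / \<beta>) * norm (orth_proj U\<^sub>M (uk_true k) - uk_DL k) \<and>
     norm (uk_true k - uk_SVDA k)
       \<le> (1 + 1 / \<beta>) * (INF p \<in> U\<^sub>M \<inter> Z\<^sup>\<bottom>. norm (orth_proj (Z\<^sup>\<bottom>) (uk_true k) - p))
         + (1 + 2 / \<beta>) * norm (orth_proj U\<^sub>M (uk_true k) - uk_DL k)"
proof
  fix k assume k: "k \<in> {1..K}"
  \<comment> \<open>The library sets the dimension of an infinite-dimensional space to 0, which \<open>N \<ge> 1\<close> excludes.\<close>
  obtain A where A: "A \<subseteq> Z" "independent A" "Z \<subseteq> span A" "card A = dim Z"
    using basis_exists[of Z] by blast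
  then have finite_A: "finite A" using background by (metis card.infinite not_one_le_zero)
  have Z_eq: "Z = span A"
    using A(1,3) background(1) by (simp add: span_minimal subset_antisym)
  \<comment> \<open>The zero space is spanned by the empty set and so has dimension 0, contradicting
    \<open>N \<ge> 1\<close>.\<close>
  have "Z \<noteq> {0}" using background(2,3) dim_le_card[of Z "{}"] by auto
  then interpret stable_pair Z U\<^sub>M A "q ` {1..M}"
    using finite_A Z_eq observable stable by unfold_locales auto
  \<comment> \<open>\<open>P\<close> fixes the predicted field, which lies in the observable
    space.\<close>
  have "P (uk_true k - uk_DL k) = P (uk_true k) - uk_DL k"
    using linear_diff[OF linear_P] orth_proj_fixed[OF finite_B U_eq DL[OF k]] by simp
  then have "norm (uk_PBDW k - uk_SVDA k) \<le> (1 + 1 / \<beta>) * norm (P (uk_true k) - uk_DL k)"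
    using norm_state_estimate_diff_le[of "uk_true k" "uk_DL k"] k by (simp add: PBDW SVDA beta)
  \<comment> \<open>The sharper constant \<open>1 + 1/\<beta>\<close> is relaxed to the stated one,
    using \<open>\<beta> > 0\<close>.\<close>
  also have "\<dots> \<le> (1 + 2 / \<beta>) * norm (P (uk_true k) - uk_DL k)"
    using stability_const_pos by (intro mult_right_mono) (auto simp: beta divide_right_mono)
  finally have data: "norm (uk_PBDW k - uk_SVDA k) \<le> (1 + 2 / \<beta>) * norm (P (uk_true k) - uk_DL k)" .
  \<comment> \<open>The PBDW estimate is the intermediate point: its own error gives the infimum
    term, its distance to SVDA the data term.\<close>
  have "norm (uk_true k - uk_SVDA k) \<le> norm (uk_true k - uk_PBDW k) + norm (uk_PBDW k - uk_SVDA k)"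
    by (metis diff_add_cancel add_diff_eq norm_triangle_ineq)
  with data norm_state_estimate_error_le[of "uk_true k"] k
  show "norm (uk_PBDW k - uk_SVDA k)
       \<le> (1 + 2 / \<beta>) * norm (orth_proj U\<^sub>M (uk_true k) - uk_DL k) \<and>
     norm (uk_true k - uk_SVDA k)
       \<le> (1 + 1 / \<beta>) * (INF p \<in> U\<^sub>M \<inter> Z\<^sup>\<bottom>. norm (orth_proj (Z\<^sup>\<bottom>) (uk_true k) - p))
         + (1 + 2 / \<beta>) * norm (orth_proj U\<^sub>M (uk_true k) - uk_DL k)"
    by (simp add: PBDW beta)
qed

end
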